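(* Let $d\in\mathbb N$, $a\in\mathbb N_0$. For every $m\in\mathbb N_0$, as formal power series in $x$, $$\sum_{n=m}^{\infty}S2(d,a;n,m)\,x^n=\frac{(d\,x)^m}{\prod_{j=0}^m\big(1-(a+d\,j)\,x\big)}.$$
   Context: $\mathbb N=\{1,2,\dots\}$, $\mathbb N_0=\{0,1,2,\dots\}$. The generalized Stirling numbers of the second kind $S2(d,a;n,m)$, $0\le m\le n$, are defined by the operator identity $(a\,\mathbf 1+d\,\mathbf E_x)^n=\sum_{m=0}^n S2(d,a;n,m)\,x^m\,\mathbf d_x^{\,m}$, where $\mathbf d_x$ is differentiation with respect to $x$, $\mathbf E_x:=x\,\mathbf d_x$ and $\mathbf 1$ is the identity operator. *)

theory Defs
  imports "HOL-Computational_Algebra.Formal_Power_Series"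
begin

unbundle fps_syntax

text \<open>The operators act on formal power series over an arbitrary field of characteristic 0.\<close>

definition Euler_op :: "'a::field_char_0 fps \<Rightarrow> 'a fps" where
  "Euler_op f = fps_X * fps_deriv f"

definition affine_Euler_op :: "nat \<Rightarrow> nat \<Rightarrow> 'a::field_char_0 fps \<Rightarrow> 'a fps" where
  "affine_Euler_op d a f = of_nat a * f + of_nat d * Euler_op f"

text \<open>\<open>c\<close> gives the coefficients of the expansion of the \<open>n\<close>-th power of the operator;
  outside the range \<open>0 \<le> m \<le> n\<close> they are set to 0, which makes them unique.\<close>

definition is_S2_row :: "nat \<Rightarrow> nat \<Rightarrow> nat \<Rightarrow> (nat \<Rightarrow> 'a::field_char_0) \<Rightarrow> bool" where
  "is_S2_row d a n c \<longleftrightarrow>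
     (\<forall>f. (affine_Euler_op d a ^^ n) f =
           (\<Sum>m=0..n. fps_const (c m) * (fps_X ^ m * (fps_deriv ^^ m) f))) \<and>
     (\<forall>m>n. c m = 0)"

definition S2 :: "nat \<Rightarrow> nat \<Rightarrow> nat \<Rightarrow> nat \<Rightarrow> 'a::field_char_0" where
  "S2 d a n = (THE c. is_S2_row d a n c)"

lemma Euler_op_term:
  "Euler_op (fps_const c * (fps_X ^ m * (fps_deriv ^^ m) f)) =
     fps_const (of_nat m * c) * (fps_X ^ m * (fps_deriv ^^ m) f) +
     fps_const c * (fps_X ^ Suc m * (fps_deriv ^^ Suc m) f)"
proof (cases m)
  case (Suc k)
  have "fps_deriv (fps_X ^ Suc k :: 'a fps) = of_nat (Suc k) * fps_X ^ k"
    by (auto simp: fps_eq_iff fps_of_nat[symmetric] simp del: power_Suc of_nat_Suc)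
  hence "fps_X * fps_deriv (fps_X ^ m :: 'a fps) = of_nat m * fps_X ^ m"
    by (simp add: Suc)
  hence "Euler_op (fps_const c * (fps_X ^ m * (fps_deriv ^^ m) f)) =
      fps_const c * (of_nat m * fps_X ^ m * (fps_deriv ^^ m) f +
        fps_X * fps_X ^ m * fps_deriv ((fps_deriv ^^ m) f))"
    by (simp add: Euler_op_def algebra_simps)
  thus ?thesis
    by (simp add: algebra_simps fps_of_nat[symmetric] fps_const_mult[symmetric]
        del: fps_const_mult)
qed (simp add: Euler_op_def algebra_simps)

lemma Euler_op_sum: "Euler_op (\<Sum>i\<in>A. g i) = (\<Sum>i\<in>A. Euler_op (g i))"
  by (simp add: Euler_op_def fps_deriv_sum sum_distrib_left)

lemma is_S2_row_0: "is_S2_row d a 0 (\<lambda>m. if m = 0 then 1 else 0)"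
  by (simp add: is_S2_row_def)

lemma is_S2_row_Suc:
  assumes "is_S2_row d a n c"
  shows "is_S2_row d a (Suc n)
    (\<lambda>m. of_nat (a + d * m) * c m + (if m = 0 then 0 else of_nat d * c (m - 1)))"
    (is "is_S2_row _ _ _ ?c'")
  unfolding is_S2_row_def
proof (intro conjI allI impI)
  fix f :: "'a fps"
  define t where "t m = fps_X ^ m * (fps_deriv ^^ m) f" for m
  have top: "c (Suc n) = 0" using assms by (simp add: is_S2_row_def)
  have "(affine_Euler_op d a ^^ Suc n) f = affine_Euler_op d a (\<Sum>m=0..n. fps_const (c m) * t m)"
    using assms by (simp add: is_S2_row_def t_def)
  also have "\<dots> = (\<Sum>m=0..n. of_nat a * (fps_const (c m) * t m) +
                of_nat d * (fps_const (of_nat m * c m) * t m + fps_const (c m) * t (Suc m)))"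
    unfolding affine_Euler_op_def Euler_op_sum sum_distrib_left sum.distrib[symmetric]
    by (intro sum.cong refl) (simp only: t_def Euler_op_term)
  also have "\<dots> = (\<Sum>m=0..n. fps_const (of_nat (a + d * m) * c m) * t m) +
                  (\<Sum>m=0..n. fps_const (of_nat d * c m) * t (Suc m))"
    unfolding sum.distrib[symmetric]
    by (intro sum.cong refl)
       (simp add: fps_of_nat[symmetric] fps_const_mult[symmetric] fps_const_add[symmetric]
          algebra_simps del: fps_const_mult fps_const_add)
  also have "(\<Sum>m=0..n. fps_const (of_nat (a + d * m) * c m) * t m) =
             (\<Sum>m=0..Suc n. fps_const (of_nat (a + d * m) * c m) * t m)"
    by (simp add: top)
  also have "(\<Sum>m=0..n. fps_const (of_nat d * c m) * t (Suc m)) =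
      (\<Sum>m=0..Suc n. fps_const (if m = 0 then 0 else of_nat d * c (m - 1)) * t m)"
    unfolding sum.atLeast0_atMost_Suc_shift by simp
  finally show "(affine_Euler_op d a ^^ Suc n) f =
      (\<Sum>m=0..Suc n. fps_const (?c' m) * (fps_X ^ m * (fps_deriv ^^ m) f))"
    by (simp only: t_def sum.distrib[symmetric] distrib_right[symmetric] fps_const_add)
next
  fix m assume "Suc n < m"
  thus "?c' m = 0" using assms by (simp add: is_S2_row_def)
qed

lemma is_S2_row_unique:
  fixes c c' :: "nat \<Rightarrow> 'a::field_char_0"
  assumes "is_S2_row d a n c" "is_S2_row d a n c'"
  shows "c = c'"
proof
  fix k show "c k = c' k"
  proof (induction k rule: less_induct)
    case (less k)
    show ?case
    proof (cases "k \<le> n")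
      case True
      define f :: "'a fps" where "f = fps_X ^ k"
      define w where "w m = (fps_X ^ m * (fps_deriv ^^ m) f) $ k" for m
      have w_gt: "w m = 0" if "m > k" for m
        using that by (simp add: w_def fps_X_power_mult_nth)
      have w_k: "w k \<noteq> 0"
        by (simp add: w_def fps_X_power_mult_nth fps_0th_higher_deriv f_def fps_X_power_nth)
      have e: "(\<Sum>m=0..n. b m * w m) = ((affine_Euler_op d a ^^ n) f) $ k"
        if "is_S2_row d a n b" for b
        using that by (simp add: is_S2_row_def fps_sum_nth w_def)
      have "0 = (\<Sum>m=0..n. (c m - c' m) * w m)"
        using e[OF assms(1)] e[OF assms(2)] by (simp add: left_diff_distrib sum_subtractf)
      also have "\<dots> = (\<Sum>m\<in>{k}. (c m - c' m) * w m)"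
      proof (rule sum.mono_neutral_right)
        show "\<forall>m\<in>{0..n} - {k}. (c m - c' m) * w m = 0"
          using less w_gt by (metis DiffE diff_self insertI1 linorder_neqE_nat mult_zero_left mult_zero_right)
      qed (use True in auto)
      finally show ?thesis using w_k by simp
    qed (use assms in \<open>simp add: is_S2_row_def\<close>)
  qed
qed

lemma is_S2_row_S2: "is_S2_row d a n (S2 d a n :: nat \<Rightarrow> 'a::field_char_0)"
proof -
  have "\<exists>c :: nat \<Rightarrow> 'a. is_S2_row d a n c"
    by (induction n) (use is_S2_row_0 is_S2_row_Suc in blast)+
  thus ?thesis
    unfolding S2_def by (metis is_S2_row_unique theI)
qed

end

theory Submission
  imports Defs
begin

text \<open>Applying a + d E to x^m D^m yields (a + d m) x^m D^m + d x^(m+1) D^(m+1), so uniqueness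
  of the expansion gives the triangular recurrence \<open>S2_Suc\<close>. For the column series G_m
  it reads (1 - (a + d m) x) G_m = d x G_(m-1), with (1 - a x) G_0 = 1 (\<open>fps_S2_rec\<close>).
  Iterating down to G_0 turns the product of the linear factors times G_m into (d x)^m
  (\<open>prod_mult_fps_S2\<close>); dividing by the nonzero product gives the claim.\<close>

lemma S2_0: "(S2 d a 0 m :: 'a::field_char_0) = (if m = 0 then 1 else 0)"
  using is_S2_row_unique[OF is_S2_row_S2[where 'a='a] is_S2_row_0] by metis

lemma S2_Suc:
  "(S2 d a (Suc n) m :: 'a::field_char_0) =
     of_nat (a + d * m) * S2 d a n m + (if m = 0 then 0 else of_nat d * S2 d a n (m - 1))"
  using is_S2_row_unique[OF is_S2_row_S2[where 'a='a] is_S2_row_Suc[OF is_S2_row_S2]] by metis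

lemma S2_eq_0: "n < m \<Longrightarrow> (S2 d a n m :: 'a::field_char_0) = 0"
  using is_S2_row_S2[of d a n, where 'a='a] by (simp add: is_S2_row_def)

text \<open>Coefficientwise, this is \<open>S2_0\<close> in degree 0 and \<open>S2_Suc\<close> in
  positive degrees; the 1 for m = 0 is the initial value in row 0.\<close>

lemma fps_S2_rec:
  "(1 - of_nat (a + d * m) * fps_X) * Abs_fps (\<lambda>n. S2 d a n m) =
     (if m = 0 then 1 else of_nat d * fps_X * Abs_fps (\<lambda>n. S2 d a n (m - 1)) :: 'a::field_char_0 fps)"
proof (rule fps_ext)
  fix n
  \<comment> \<open>Stated for arbitrary k, so that it covers both factors, a + d m and d.\<close>
  have "(of_nat k * fps_X * g) $ n = (if n = 0 then 0 else of_nat k * g $ (n - 1))"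
    for k and g :: "'a fps"
    by (simp add: fps_of_nat[symmetric] mult.assoc)
  then show "((1 - of_nat (a + d * m) * fps_X) * Abs_fps (\<lambda>n. S2 d a n m)) $ n =
    (if m = 0 then 1 else of_nat d * fps_X * Abs_fps (\<lambda>n. S2 d a n (m - 1)) :: 'a fps) $ n"
    by (cases n) (simp_all add: left_diff_distrib S2_0 S2_Suc del: of_nat_add of_nat_mult)
qed

text \<open>Free of division, so the induction on m only has to absorb the top factor with
  \<open>fps_S2_rec\<close>.\<close>

lemma prod_mult_fps_S2:
  "(\<Prod>j=0..m. 1 - of_nat (a + d * j) * fps_X) * Abs_fps (\<lambda>n. S2 d a n m) =
     ((of_nat d * fps_X) ^ m :: 'a::field_char_0 fps)"
proof (induction m)
  case 0
  then show ?case using fps_S2_rec[of a d 0] by simp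
next
  case (Suc m)
  let ?P = "\<Prod>j=0..m. 1 - of_nat (a + d * j) * fps_X :: 'a fps"
  have "(\<Prod>j=0..Suc m. 1 - of_nat (a + d * j) * fps_X) * Abs_fps (\<lambda>n. S2 d a n (Suc m)) =
      ?P * ((1 - of_nat (a + d * Suc m) * fps_X) * Abs_fps (\<lambda>n. S2 d a n (Suc m)))"
    by (simp only: prod.atLeast0_atMost_Suc mult.assoc)
  also have "\<dots> = of_nat d * fps_X * (?P * Abs_fps (\<lambda>n. S2 d a n m))"
    unfolding fps_S2_rec by (simp add: mult_ac)
  finally show ?case by (simp only: Suc.IH power_Suc)
qed

theorem mainTheorem7:
  fixes d a m :: nat
  assumes "d \<ge> 1"
  shows "Abs_fps (\<lambda>n. if m \<le> n then S2 d a n m else 0) =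
    ((of_nat d * fps_X) ^ m / (\<Prod>j=0..m. 1 - of_nat (a + d * j) * fps_X) :: 'a::field_char_0 fps)"
proof -
  let ?P = "\<Prod>j=0..m. 1 - of_nat (a + d * j) * fps_X :: 'a fps"
  \<comment> \<open>The constant coefficient is 1.\<close>
  have "1 - of_nat k * fps_X \<noteq> (0 :: 'a fps)" for k
    by (rule fps_nonzeroI[of _ 0]) simp
  then have nz: "?P \<noteq> 0" by (simp del: of_nat_add of_nat_mult)
  \<comment> \<open>Starting the sum at n = m loses nothing, as entries with n < m vanish.\<close>
  have "Abs_fps (\<lambda>n. if m \<le> n then S2 d a n m else 0) = (Abs_fps (\<lambda>n. S2 d a n m) :: 'a fps)"
    by (auto simp: fps_eq_iff S2_eq_0)
  also have "\<dots> = ?P * Abs_fps (\<lambda>n. S2 d a n m) / ?P"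
    using nz by (rule nonzero_mult_div_cancel_left[symmetric])
  finally show ?thesis by (simp only: prod_mult_fps_S2)
qed

end
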